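(* Let $X\in\mathbb{R}^{n\times p}$, $Y\in\mathbb{R}^{n\times q}$, $\lambda>0$. Let $(\hat B,\hat S)$ be either (a) a minimizer over $B\in\mathbb{R}^{p\times q}$ and symmetric positive definite $S\in\mathbb{R}^{n\times n}$ of $\frac{1}{2nq}\operatorname{Tr}((Y-XB)^\top S^{-1}(Y-XB))+\frac{1}{2n}\operatorname{Tr}(S)+\lambda\|B\|_{2,1}$; or (b) for given $0<\sigma_{\min}<\sigma_{\max}$, a minimizer over $B\in\mathbb{R}^{p\times q}$ and symmetric $S$ with $\sigma_{\max}\mathrm{Id}_n\succeq S\succeq\sigma_{\min}\mathrm{Id}_n$ of $\frac{1}{2nq}\operatorname{Tr}((Y-XB)^\top S^{-1}(Y-XB))+\frac{\operatorname{Tr}S}{2n}+\lambda\|B\|_{2,1}$. Let $\hat E=Y-X\hat B$. Then $$\|X^\top\hat E\|_{2,\infty}\le\|\hat S\|_2\,\|X^\top\hat S^{-1}\hat E\|_{2,\infty}.$$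
   Context: $\|M\|_{2,\infty}=\max_j\|M_{j:}\|_2$ is the maximum Euclidean norm of the rows of $M$; $\|\cdot\|_2$ is the operator (spectral) norm; $\succeq$ is the Loewner order. *)

theory Defs
  imports "HOL-Analysis.Analysis"
begin

text \<open>Matrices M :: real^'c^'r are r x c; row j is M $ j (a vector in real^'c, Euclidean norm).\<close>

definition norm21 :: "real^'c^'r \<Rightarrow> real" where
  "norm21 M = (\<Sum>j\<in>UNIV. norm (M $ j))"

definition norm2inf :: "real^'c^'r \<Rightarrow> real" where
  "norm2inf M = Max ((\<lambda>j. norm (M $ j)) ` UNIV)"

text \<open>Spectral norm: operator norm w.r.t. Euclidean norms.\<close>
definition opnorm2 :: "real^'c^'r \<Rightarrow> real" where
  "opnorm2 M = onorm (\<lambda>x. M *v x)"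

definition symmetric_mat :: "real^'n^'n \<Rightarrow> bool" where
  "symmetric_mat S \<longleftrightarrow> transpose S = S"

definition pos_def :: "real^'n^'n \<Rightarrow> bool" where
  "pos_def S \<longleftrightarrow> symmetric_mat S \<and> (\<forall>x. x \<noteq> 0 \<longrightarrow> x \<bullet> (S *v x) > 0)"

text \<open>Loewner order: A \<succeq> B iff A - B is positive semidefinite (for symmetric A, B).\<close>
definition loewner_ge :: "real^'n^'n \<Rightarrow> real^'n^'n \<Rightarrow> bool" where
  "loewner_ge A B \<longleftrightarrow> (\<forall>x. x \<bullet> ((A - B) *v x) \<ge> 0)"

definition objective ::
  "real \<Rightarrow> real^'p^'n \<Rightarrow> real^'q^'n \<Rightarrow> real^'q^'p \<Rightarrow> real^'n^'n \<Rightarrow> real" where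
  "objective lam X Y B S =
     trace (transpose (Y - X ** B) ** matrix_inv S ** (Y - X ** B)) / (2 * real CARD('n) * real CARD('q))
     + trace S / (2 * real CARD('n)) + lam * norm21 B"

definition feasible_a :: "real^'n^'n \<Rightarrow> bool" where
  "feasible_a S \<longleftrightarrow> pos_def S"

definition feasible_b :: "real \<Rightarrow> real \<Rightarrow> real^'n^'n \<Rightarrow> bool" where
  "feasible_b smin smax S \<longleftrightarrow> symmetric_mat S \<and>
     loewner_ge (smax *\<^sub>R mat 1) S \<and> loewner_ge S (smin *\<^sub>R mat 1)"

end

(* If S is feasible, so is Q S Q^T for every orthogonal Q; it has the same trace and
   (Q S Q^T)^-1 = Q S^-1 Q^T. Hence, with P = S^-1 and A = E E^T for the residual E, the
   minimiser makes Q |-> Tr (Q P Q^T A) minimal at Q = Id. Differentiating along rotations in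
   a coordinate plane shows that P A is symmetric, i.e. P and therefore S commute with A.
   For symmetric S commuting with A, the numbers n_k = |E^T S^k y| satisfy
   n_(k+1)^2 = <E^T S^k y, E^T S^(k+2) y> <= n_k n_(k+2) and grow at most like |S|_2^k, and a
   log-convex sequence with this growth has n_1 <= |S|_2 n_0. Taking y = S^-1 x for each
   column x of X gives the inequality row by row. *)

theory Submission
  imports Defs
begin

section \<open>Matrix algebra\<close>

lemma matrix_diff_ldistrib: "(A::real^'n^'m) ** (B - C) = A ** B - A ** C"
  by (simp add: matrix_matrix_mult_def vec_eq_iff sum_subtractf algebra_simps)

lemma matrix_add_rdistrib: "((A::real^'n^'m) + B) ** C = A ** C + B ** C"
  by (simp add: matrix_matrix_mult_def vec_eq_iff sum.distrib algebra_simps)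

lemma matrix_diff_rdistrib: "((A::real^'n^'m) - B) ** C = A ** C - B ** C"
  by (simp add: matrix_matrix_mult_def vec_eq_iff sum_subtractf algebra_simps)

lemma matrix_mul_scaleR_left [simp]: "(k *\<^sub>R (A::real^'n^'m)) ** B = k *\<^sub>R (A ** B)"
  by (simp add: scalar_matrix_assoc)

lemma matrix_mul_scaleR_right [simp]: "(A::real^'n^'m) ** (k *\<^sub>R B) = k *\<^sub>R (A ** B)"
  by (simp add: matrix_scalar_ac)

lemma transpose_add: "transpose ((A::real^'n^'m) + B) = transpose A + transpose B"
  by (simp add: transpose_def vec_eq_iff)

lemma transpose_diff: "transpose ((A::real^'n^'m) - B) = transpose A - transpose B"
  by (simp add: transpose_def vec_eq_iff)

lemma trace_scaleR: "trace (k *\<^sub>R (A::real^'n^'n)) = k * trace A"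
  by (simp add: trace_def sum_distrib_left)

lemma inner_transpose_left: "inner (transpose M *v u) v = inner u ((M::real^'m^'n) *v v)"
  by (simp add: dot_lmul_matrix)

lemma inner_transpose_mult:
  fixes E :: "real^'q^'n"
  shows "inner (transpose E *v u) (transpose E *v v) = inner u ((E ** transpose E) *v v)"
  by (simp only: inner_transpose_left matrix_vector_mul_assoc)

lemma inner_conj_quadratic_form:
  fixes Q M :: "real^'n^'n"
  shows "inner x ((Q ** M ** transpose Q) *v x) = inner (transpose Q *v x) (M *v (transpose Q *v x))"
  by (simp only: inner_transpose_left matrix_vector_mul_assoc matrix_mul_assoc transpose_transpose)

lemma symmetric_mat_conj:
  fixes Q M :: "real^'n^'n"
  assumes "symmetric_mat M"
  shows "symmetric_mat (Q ** M ** transpose Q)"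
  using assms unfolding symmetric_mat_def by (simp add: matrix_transpose_mul matrix_mul_assoc)

lemma trace_orthogonal_conj:
  fixes Q S :: "real^'n^'n"
  assumes "orthogonal_matrix Q"
  shows "trace (Q ** S ** transpose Q) = trace S"
proof -
  have "trace (Q ** S ** transpose Q) = trace (S ** transpose Q ** Q)"
    by (metis matrix_mul_assoc trace_mul_sym)
  with assms show ?thesis
    by (simp add: orthogonal_matrix_def matrix_mul_assoc[symmetric])
qed

lemma trace_transpose_sandwich:
  fixes E :: "real^'q^'n" and M :: "real^'n^'n"
  shows "trace (transpose E ** M ** E) = trace (M ** (E ** transpose E))"
  by (metis matrix_mul_assoc trace_mul_sym)

lemma row_transpose_mult:
  fixes M :: "real^'p^'n" and E :: "real^'q^'n"
  shows "(transpose M ** E) $ j = transpose E *v column j M"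
  by (simp add: vec_eq_iff matrix_matrix_mult_def matrix_vector_mult_def transpose_def column_def
      mult.commute del: transpose_matrix_vector)

lemma column_mult: "column j ((P::real^'n^'m) ** M) = P *v column j M"
  by (simp add: vec_eq_iff matrix_matrix_mult_def matrix_vector_mult_def column_def)

section \<open>Inverses and conjugation\<close>

lemma matrix_inv_unique:
  fixes A B :: "real^'n^'n"
  assumes "A ** B = mat 1"
  shows "matrix_inv A = B"
proof -
  have "B ** A = mat 1" using assms matrix_left_right_inverse by blast
  with assms have "A ** matrix_inv A = mat 1 \<and> matrix_inv A ** A = mat 1"
    unfolding matrix_inv_def by (rule someI[of _ B, OF conjI])
  then have "matrix_inv A ** (A ** B) = B" by (simp add: matrix_mul_assoc)
  with assms show ?thesis by simp
qed

lemma matrix_inv_right: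
  fixes A :: "real^'n^'n"
  assumes "invertible A"
  shows "A ** matrix_inv A = mat 1"
  using assms matrix_inv_unique unfolding invertible_def by metis

lemma matrix_inv_left:
  fixes A :: "real^'n^'n"
  assumes "invertible A"
  shows "matrix_inv A ** A = mat 1"
  using matrix_inv_right[OF assms] matrix_left_right_inverse by blast

lemma symmetric_matrix_inv:
  fixes S :: "real^'n^'n"
  assumes "symmetric_mat S" "invertible S"
  shows "symmetric_mat (matrix_inv S)"
proof -
  have "transpose (matrix_inv S) ** S = mat 1"
    using arg_cong[OF matrix_inv_right[OF assms(2)], of transpose] assms(1)
    by (simp add: matrix_transpose_mul symmetric_mat_def)
  then have "matrix_inv S = transpose (matrix_inv S)"
    using matrix_inv_unique matrix_left_right_inverse by metis
  then show ?thesis by (simp add: symmetric_mat_def)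
qed

lemma commute_of_matrix_inv_commute:
  fixes S A :: "real^'n^'n"
  assumes "invertible S" "matrix_inv S ** A = A ** matrix_inv S"
  shows "S ** A = A ** S"
proof -
  have "S ** A = S ** (A ** matrix_inv S) ** S"
    by (simp add: matrix_mul_assoc[symmetric] matrix_inv_left[OF assms(1)])
  also have "\<dots> = A ** S"
    by (simp add: assms(2)[symmetric] matrix_mul_assoc matrix_inv_right[OF assms(1)])
  finally show ?thesis .
qed

lemma matrix_inv_orthogonal_conj:
  fixes Q S :: "real^'n^'n"
  assumes Q: "orthogonal_matrix Q" and S: "invertible S"
  shows "matrix_inv (Q ** S ** transpose Q) = Q ** matrix_inv S ** transpose Q"
proof (rule matrix_inv_unique)
  have "Q ** S ** transpose Q ** (Q ** matrix_inv S ** transpose Q)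
      = Q ** S ** (transpose Q ** Q) ** matrix_inv S ** transpose Q"
    by (simp add: matrix_mul_assoc)
  also have "\<dots> = mat 1"
    using Q by (simp add: orthogonal_matrix_def matrix_mul_assoc[symmetric] matrix_inv_right[OF S])
  finally show "Q ** S ** transpose Q ** (Q ** matrix_inv S ** transpose Q) = mat 1" .
qed

lemma pos_def_invertible:
  fixes S :: "real^'n^'n"
  assumes "pos_def S"
  shows "invertible S"
proof -
  have "S *v x = 0 \<Longrightarrow> x = 0" for x
    using assms unfolding pos_def_def by (metis inner_zero_right less_irrefl)
  then show ?thesis
    by (simp add: invertible_left_inverse matrix_left_invertible_ker)
qed

lemma pos_def_orthogonal_conj:
  fixes Q S :: "real^'n^'n"
  assumes "orthogonal_matrix Q" "pos_def S"
  shows "pos_def (Q ** S ** transpose Q)"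
proof -
  have "transpose Q *v x \<noteq> 0" if "x \<noteq> 0" for x
    using assms(1) that
    by (metis matrix_vector_mul_assoc matrix_vector_mul_lid matrix_vector_mult_0_right
        orthogonal_matrix_def)
  with assms(2) show ?thesis
    unfolding pos_def_def by (simp add: symmetric_mat_conj inner_conj_quadratic_form)
qed

lemma loewner_ge_conj:
  fixes Q A B :: "real^'n^'n"
  assumes "loewner_ge A B"
  shows "loewner_ge (Q ** A ** transpose Q) (Q ** B ** transpose Q)"
proof -
  have "Q ** A ** transpose Q - Q ** B ** transpose Q = Q ** (A - B) ** transpose Q"
    by (simp add: matrix_diff_ldistrib matrix_diff_rdistrib)
  with assms show ?thesis
    unfolding loewner_ge_def by (simp add: inner_conj_quadratic_form)
qed

section \<open>Rotations in a coordinate plane\<close>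

definition matrix_unit :: "'n::finite \<Rightarrow> 'n \<Rightarrow> real^'n^'n" where
  "matrix_unit i j = (\<chi> r c. if r = i \<and> c = j then 1 else 0)"

lemma matrix_unit_mult_left: "matrix_unit i j ** M = (\<chi> r. if r = i then M $ j else 0)"
proof -
  have "(\<Sum>k\<in>UNIV. (if r = i \<and> k = j then 1 else 0) * M $ k $ c) = (if r = i then M $ j $ c else 0)"
    for r c
  proof -
    have "(\<Sum>k\<in>UNIV. (if r = i \<and> k = j then 1 else 0) * M $ k $ c)
        = (\<Sum>k\<in>UNIV. if k = j then (if r = i then M $ j $ c else 0) else 0)"
      by (rule sum.cong) auto
    then show ?thesis by simp
  qed
  then show ?thesis
    unfolding matrix_unit_def matrix_matrix_mult_def by (simp add: vec_eq_iff)
qed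

lemma matrix_unit_mult: "matrix_unit a b ** matrix_unit c d = (if b = c then matrix_unit a d else 0)"
  unfolding matrix_unit_mult_left by (auto simp: vec_eq_iff matrix_unit_def)

lemma transpose_matrix_unit [simp]: "transpose (matrix_unit i j) = matrix_unit j i"
  by (auto simp: matrix_unit_def transpose_def vec_eq_iff)

lemma trace_matrix_unit_mult: "trace (matrix_unit i j ** M) = M $ j $ i"
  by (simp add: matrix_unit_mult_left trace_def if_distrib if_distribR cong: if_cong)

definition plane_projection :: "'n::finite \<Rightarrow> 'n \<Rightarrow> real^'n^'n" where
  "plane_projection i j = matrix_unit i i + matrix_unit j j"

definition plane_skew :: "'n::finite \<Rightarrow> 'n \<Rightarrow> real^'n^'n" where
  "plane_skew i j = matrix_unit j i - matrix_unit i j"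

definition plane_rotation :: "'n::finite \<Rightarrow> 'n \<Rightarrow> real \<Rightarrow> real \<Rightarrow> real^'n^'n" where
  "plane_rotation i j c s = mat 1 + (c - 1) *\<^sub>R plane_projection i j + s *\<^sub>R plane_skew i j"

lemma transpose_plane_projection [simp]: "transpose (plane_projection i j) = plane_projection i j"
  by (simp add: plane_projection_def transpose_add)

lemma transpose_plane_skew [simp]: "transpose (plane_skew i j) = - plane_skew i j"
  by (simp add: plane_skew_def transpose_diff)

context
  fixes i j :: "'n::finite"
  assumes ij: "i \<noteq> j"
begin

lemma plane_projection_mult_self [simp]:
  "plane_projection i j ** plane_projection i j = plane_projection i j"
  using ij by (simp add: plane_projection_def matrix_add_ldistrib matrix_add_rdistrib matrix_unit_mult)

lemma plane_projection_mult_skew [simp]: "plane_projection i j ** plane_skew i j = plane_skew i j"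
  using ij by (simp add: plane_projection_def plane_skew_def matrix_add_rdistrib matrix_diff_ldistrib
      matrix_unit_mult)

lemma plane_skew_mult_projection [simp]: "plane_skew i j ** plane_projection i j = plane_skew i j"
  using ij by (simp add: plane_projection_def plane_skew_def matrix_add_ldistrib matrix_diff_rdistrib
      matrix_unit_mult)

lemma plane_skew_mult_self [simp]: "plane_skew i j ** plane_skew i j = - plane_projection i j"
  using ij by (simp add: plane_projection_def plane_skew_def matrix_diff_ldistrib matrix_diff_rdistrib
      matrix_unit_mult)

lemma orthogonal_plane_rotation:
  assumes "c\<^sup>2 + s\<^sup>2 = 1"
  shows "orthogonal_matrix (plane_rotation i j c s)"
proof -
  let ?U = "plane_projection i j" and ?K = "plane_skew i j"
  have product: "(mat 1 + a *\<^sub>R ?U - s *\<^sub>R ?K) ** (mat 1 + a *\<^sub>R ?U + s *\<^sub>R ?K)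
      = mat 1 + (a + a + a\<^sup>2 + s\<^sup>2) *\<^sub>R ?U" for a
    by (simp add: matrix_add_ldistrib matrix_add_rdistrib matrix_diff_rdistrib vec_eq_iff
        algebra_simps power2_eq_square)
  have "transpose (plane_rotation i j c s) = mat 1 + (c - 1) *\<^sub>R ?U - s *\<^sub>R ?K"
    by (simp add: plane_rotation_def transpose_add transpose_scalar)
  then have "transpose (plane_rotation i j c s) ** plane_rotation i j c s
      = mat 1 + ((c - 1) + (c - 1) + (c - 1)\<^sup>2 + s\<^sup>2) *\<^sub>R ?U"
    unfolding plane_rotation_def by (simp only: product)
  also have "(c - 1) + (c - 1) + (c - 1)\<^sup>2 + s\<^sup>2 = 0"
    using assms by (simp add: power2_eq_square algebra_simps)
  finally show ?thesis by (simp add: orthogonal_matrix)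
qed

lemma trace_plane_skew_first_order:
  fixes P A :: "real^'n^'n"
  assumes min: "\<And>Q. orthogonal_matrix Q \<Longrightarrow> trace (P ** A) \<le> trace (Q ** P ** transpose Q ** A)"
  shows "trace (plane_skew i j ** P ** A) = trace (P ** plane_skew i j ** A)"
proof -
  let ?U = "plane_projection i j" and ?K = "plane_skew i j"
  define f where "f t = trace (plane_rotation i j (cos t) (sin t) ** P **
    transpose (plane_rotation i j (cos t) (sin t)) ** A)" for t
  have expand: "trace ((mat 1 + a *\<^sub>R ?U + s *\<^sub>R ?K) ** P ** (mat 1 + a *\<^sub>R ?U - s *\<^sub>R ?K) ** A)
      = trace (P ** A) + a * (trace (?U ** P ** A) + trace (P ** ?U ** A))
        + s * (trace (?K ** P ** A) - trace (P ** ?K ** A)) + a\<^sup>2 * trace (?U ** P ** ?U ** A)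
        + a * s * (trace (?K ** P ** ?U ** A) - trace (?U ** P ** ?K ** A))
        - s\<^sup>2 * trace (?K ** P ** ?K ** A)" for a s
    by (simp add: matrix_add_ldistrib matrix_add_rdistrib matrix_diff_ldistrib matrix_diff_rdistrib
        trace_add trace_sub trace_scaleR algebra_simps power2_eq_square)
  have "transpose (plane_rotation i j c s) = mat 1 + (c - 1) *\<^sub>R ?U - s *\<^sub>R ?K" for c s
    by (simp add: plane_rotation_def transpose_add transpose_scalar)
  then have f_eq: "f t = trace (P ** A) + (cos t - 1) * (trace (?U ** P ** A) + trace (P ** ?U ** A))
        + sin t * (trace (?K ** P ** A) - trace (P ** ?K ** A)) + (cos t - 1)\<^sup>2 * trace (?U ** P ** ?U ** A)
        + (cos t - 1) * sin t * (trace (?K ** P ** ?U ** A) - trace (?U ** P ** ?K ** A))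
        - (sin t)\<^sup>2 * trace (?K ** P ** ?K ** A)" for t
    unfolding f_def plane_rotation_def by (simp only: expand)
  \<comment> \<open>cos t - 1 and all products of two coefficients have derivative 0 at t = 0,
    so only the sin t term contributes.\<close>
  have "(f has_real_derivative trace (?K ** P ** A) - trace (P ** ?K ** A)) (at 0)"
    unfolding f_eq[abs_def] by (rule derivative_eq_intros refl | simp)+
  moreover have "f 0 \<le> f t" for t
  proof -
    have "trace (P ** A) \<le> f t"
      unfolding f_def by (rule min[OF orthogonal_plane_rotation]) simp
    then show ?thesis by (simp add: f_eq)
  qed
  ultimately have "trace (?K ** P ** A) - trace (P ** ?K ** A) = 0"
    by (metis DERIV_local_min zero_less_one)
  then show ?thesis by simp
qed

end

lemma commute_of_trace_orthogonal_conj_min: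
  fixes P A :: "real^'n^'n"
  assumes "symmetric_mat P" "symmetric_mat A"
    and min: "\<And>Q. orthogonal_matrix Q \<Longrightarrow> trace (P ** A) \<le> trace (Q ** P ** transpose Q ** A)"
  shows "P ** A = A ** P"
proof -
  have AP: "A ** P = transpose (P ** A)"
    using assms by (simp add: symmetric_mat_def matrix_transpose_mul)
  have "(P ** A) $ i $ j = (P ** A) $ j $ i" for i j
  proof (cases "i = j")
    case False
    have "trace (plane_skew i j ** P ** A) = (P ** A) $ i $ j - (P ** A) $ j $ i"
      by (simp add: plane_skew_def matrix_mul_assoc[symmetric] matrix_diff_rdistrib trace_sub
          trace_matrix_unit_mult)
    moreover have "trace (P ** plane_skew i j ** A) = trace (plane_skew i j ** (A ** P))"
      by (metis matrix_mul_assoc trace_mul_sym)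
    then have "trace (P ** plane_skew i j ** A) = (P ** A) $ j $ i - (P ** A) $ i $ j"
      by (simp add: plane_skew_def matrix_diff_rdistrib trace_sub trace_matrix_unit_mult AP
          transpose_def)
    ultimately show ?thesis
      using trace_plane_skew_first_order[OF False min] by simp
  qed simp
  then have "transpose (P ** A) = P ** A"
    by (simp add: transpose_def vec_eq_iff)
  with AP show ?thesis by simp
qed

section \<open>Log-convexity and the row-wise bound\<close>

lemma log_convex_geometric_lower_bound:
  fixes n :: "nat \<Rightarrow> real"
  assumes nonneg: "\<And>k. 0 \<le> n k"
    and log_convex: "\<And>k. (n (Suc k))\<^sup>2 \<le> n k * n (Suc (Suc k))"
  shows "(n 1 / n 0) ^ k * n 0 \<le> n k"
proof -
  define r where "r = n 1 / n 0"
  have r_nonneg: "0 \<le> r"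
    unfolding r_def using nonneg by simp
  have ratio: "r * n k \<le> n (Suc k)" for k
  proof (induction k)
    case 0
    show ?case
      using nonneg[of 1] by (cases "n 0 = 0") (simp_all add: r_def)
  next
    case (Suc k)
    show ?case
    proof (cases "n k = 0")
      case True
      with log_convex[of k] have "n (Suc k) = 0" by simp
      with nonneg show ?thesis by simp
    next
      case False
      then have "0 < n k" using nonneg[of k] by simp
      have "n k * (r * n (Suc k)) = (r * n k) * n (Suc k)" by simp
      also have "\<dots> \<le> (n (Suc k))\<^sup>2"
        using Suc.IH nonneg[of "Suc k"] by (simp add: power2_eq_square mult_right_mono)
      also have "\<dots> \<le> n k * n (Suc (Suc k))" by (rule log_convex)
      finally show ?thesis using \<open>0 < n k\<close> by simp
    qed
  qed
  show ?thesis
    unfolding r_def[symmetric]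
  proof (induction k)
    case (Suc k)
    have "r ^ Suc k * n 0 = r * (r ^ k * n 0)" by simp
    also have "\<dots> \<le> r * n k" using Suc.IH r_nonneg by (rule mult_left_mono)
    also have "\<dots> \<le> n (Suc k)" by (rule ratio)
    finally show ?case .
  qed simp
qed

lemma log_convex_ratio_le_growth_rate:
  fixes n :: "nat \<Rightarrow> real"
  assumes nonneg: "\<And>k. 0 \<le> n k"
    and log_convex: "\<And>k. (n (Suc k))\<^sup>2 \<le> n k * n (Suc (Suc k))"
    and growth: "\<And>k. n k \<le> C * c ^ k" and "0 \<le> c"
  shows "n 1 \<le> c * n 0"
proof (rule ccontr)
  assume "\<not> n 1 \<le> c * n 0"
  then have less: "c * n 0 < n 1" by simp
  have "0 < n 0"
  proof (rule ccontr)
    assume "\<not> 0 < n 0"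
    with nonneg[of 0] have "n 0 = 0" by simp
    with log_convex[of 0] less show False by simp
  qed
  define r where "r = n 1 / n 0"
  have "c < r"
    unfolding r_def using less \<open>0 < n 0\<close> by (simp add: field_simps)
  have geometric: "r ^ k * n 0 \<le> C * c ^ k" for k
    unfolding r_def using log_convex_geometric_lower_bound[of n, OF nonneg log_convex] growth
    by (rule order_trans)
  show False
  proof (cases "c = 0")
    case True
    with geometric[of 1] less \<open>0 < n 0\<close> show False by (simp add: r_def)
  next
    case False
    with \<open>0 \<le> c\<close> have "0 < c" by simp
    with \<open>c < r\<close> have "1 < r / c" by simp
    then obtain k where k: "C / n 0 < (r / c) ^ k"
      using real_arch_pow by blast
    have "(r / c) ^ k * n 0 \<le> C"
      using geometric[of k] \<open>0 < c\<close> by (simp add: power_divide field_simps)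
    with k \<open>0 < n 0\<close> show False by (simp add: field_simps)
  qed
qed

lemma norm_transpose_mult_commuting_le:
  fixes S :: "real^'n^'n" and E :: "real^'q^'n"
  assumes sym: "symmetric_mat S" and comm: "S ** (E ** transpose E) = (E ** transpose E) ** S"
  shows "norm (transpose E *v (S *v y)) \<le> opnorm2 S * norm (transpose E *v y)"
proof -
  let ?F = "\<lambda>v. transpose E *v v" and ?A = "E ** transpose E"
  define n where "n k = norm (?F (((*v) S ^^ k) y))" for k
  have shift: "inner (?F (S *v w)) (?F (S *v w)) = inner (?F w) (?F (S *v (S *v w)))" for w
  proof -
    have "inner (?F (S *v w)) (?F (S *v w)) = inner (S *v w) (?A *v (S *v w))"
      by (rule inner_transpose_mult)
    also have "\<dots> = inner (transpose S *v w) (?A *v (S *v w))"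
      using sym by (simp add: symmetric_mat_def)
    also have "\<dots> = inner w ((S ** ?A ** S) *v w)"
      by (simp only: inner_transpose_left matrix_vector_mul_assoc matrix_mul_assoc)
    also have "S ** ?A ** S = ?A ** S ** S"
      by (simp only: comm)
    also have "inner w ((?A ** S ** S) *v w) = inner w (?A *v (S *v (S *v w)))"
      by (simp only: matrix_vector_mul_assoc matrix_mul_assoc)
    also have "\<dots> = inner (?F w) (?F (S *v (S *v w)))"
      by (rule inner_transpose_mult[symmetric])
    finally show ?thesis .
  qed
  have log_convex: "(n (Suc k))\<^sup>2 \<le> n k * n (Suc (Suc k))" for k
    using shift[of "((*v) S ^^ k) y"] norm_cauchy_schwarz
    by (simp add: n_def power2_norm_eq_inner)
  have growth: "n k \<le> (opnorm2 (transpose E) * norm y) * opnorm2 S ^ k" for k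
  proof -
    have "norm (((*v) S ^^ k) y) \<le> opnorm2 S ^ k * norm y"
    proof (induction k)
      case (Suc k)
      have "norm (S *v ((*v) S ^^ k) y) \<le> opnorm2 S * norm (((*v) S ^^ k) y)"
        unfolding opnorm2_def by (rule onorm) (rule matrix_vector_mul_bounded_linear)
      also have "\<dots> \<le> opnorm2 S * (opnorm2 S ^ k * norm y)"
        using Suc.IH by (rule mult_left_mono) (simp add: opnorm2_def onorm_pos_le)
      finally show ?case by simp
    qed simp
    moreover have "0 \<le> opnorm2 (transpose E)"
      unfolding opnorm2_def by (rule onorm_pos_le) (rule matrix_vector_mul_bounded_linear)
    ultimately have "opnorm2 (transpose E) * norm (((*v) S ^^ k) y)
        \<le> opnorm2 (transpose E) * (opnorm2 S ^ k * norm y)"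
      by (rule mult_left_mono)
    moreover have "n k \<le> opnorm2 (transpose E) * norm (((*v) S ^^ k) y)"
      unfolding n_def opnorm2_def by (rule onorm) (rule matrix_vector_mul_bounded_linear)
    ultimately show ?thesis by (simp add: mult_ac)
  qed
  have "n 1 \<le> opnorm2 S * n 0"
    by (rule log_convex_ratio_le_growth_rate[OF _ log_convex growth])
      (simp_all add: n_def opnorm2_def onorm_pos_le)
  then show ?thesis by (simp add: n_def)
qed

lemma norm2inf_le_mult:
  fixes M :: "real^'c^'r" and N :: "real^'d^'r"
  assumes "\<And>j. norm (M $ j) \<le> c * norm (N $ j)" "0 \<le> c"
  shows "norm2inf M \<le> c * norm2inf N"
  unfolding norm2inf_def
proof (rule Max.boundedI)
  fix a
  assume "a \<in> range (\<lambda>j. norm (M $ j))"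
  then obtain j where "a = norm (M $ j)" by blast
  also have "\<dots> \<le> c * norm (N $ j)" by (rule assms(1))
  also have "\<dots> \<le> c * Max (range (\<lambda>j. norm (N $ j)))"
    using assms(2) by (intro mult_left_mono Max_ge) auto
  finally show "a \<le> c * Max (range (\<lambda>j. norm (N $ j)))" .
qed auto

lemma norm2inf_transpose_mult_commuting_le:
  fixes X :: "real^'p^'n" and E :: "real^'q^'n" and S :: "real^'n^'n"
  assumes sym: "symmetric_mat S" and inv: "invertible S"
    and comm: "S ** (E ** transpose E) = (E ** transpose E) ** S"
  shows "norm2inf (transpose X ** E) \<le> opnorm2 S * norm2inf (transpose X ** matrix_inv S ** E)"
proof (rule norm2inf_le_mult)
  show "0 \<le> opnorm2 S"
    unfolding opnorm2_def by (rule onorm_pos_le) (rule matrix_vector_mul_bounded_linear)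
  fix j
  let ?x = "column j X" and ?P = "matrix_inv S"
  have "transpose X ** ?P = transpose (?P ** X)"
    using symmetric_matrix_inv[OF sym inv] by (simp add: matrix_transpose_mul symmetric_mat_def)
  then have "(transpose X ** ?P ** E) $ j = transpose E *v (?P *v ?x)"
    by (simp add: row_transpose_mult column_mult del: transpose_matrix_vector)
  moreover have "S *v (?P *v ?x) = ?x"
    by (simp add: matrix_vector_mul_assoc matrix_inv_right[OF inv])
  ultimately show "norm ((transpose X ** E) $ j) \<le> opnorm2 S * norm ((transpose X ** ?P ** E) $ j)"
    using norm_transpose_mult_commuting_le[OF sym comm, of "?P *v ?x"]
    by (simp add: row_transpose_mult del: transpose_matrix_vector)
qed

section \<open>Minimisers of the objective\<close>

lemma feasible_a_orthogonal_conj: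
  "orthogonal_matrix Q \<Longrightarrow> feasible_a S \<Longrightarrow> feasible_a (Q ** S ** transpose Q)"
  unfolding feasible_a_def by (rule pos_def_orthogonal_conj)

lemma feasible_b_orthogonal_conj:
  assumes "orthogonal_matrix Q" "feasible_b smin smax S"
  shows "feasible_b smin smax (Q ** S ** transpose Q)"
proof -
  have "Q ** (c *\<^sub>R mat 1) ** transpose Q = c *\<^sub>R mat 1" for c
    using assms(1) by (simp add: orthogonal_matrix_def)
  then show ?thesis
    using assms(2) loewner_ge_conj[of _ _ Q] symmetric_mat_conj[of _ Q]
    unfolding feasible_b_def by metis
qed

lemma feasible_b_pos_def:
  fixes S :: "real^'n^'n"
  assumes "0 < smin" "feasible_b smin smax S"
  shows "pos_def S"
  unfolding pos_def_def
proof (intro conjI allI impI)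
  show "symmetric_mat S" using assms(2) by (simp add: feasible_b_def)
  fix x :: "real^'n"
  assume "x \<noteq> 0"
  have "0 \<le> inner x ((S - smin *\<^sub>R mat 1) *v x)"
    using assms(2) unfolding feasible_b_def loewner_ge_def by blast
  also have "\<dots> = inner x (S *v x) - smin * inner x x"
    by (simp add: matrix_vector_mult_diff_rdistrib inner_diff_right scaleR_matrix_vector_assoc[symmetric])
  finally have "smin * inner x x \<le> inner x (S *v x)" by simp
  moreover have "0 < smin * inner x x"
    using assms(1) \<open>x \<noteq> 0\<close> by simp
  ultimately show "0 < inner x (S *v x)" by linarith
qed

lemma trace_inv_le_of_objective_le:
  fixes X :: "real^'p^'n" and Y :: "real^'q^'n" and B :: "real^'q^'p" and Q S :: "real^'n^'n"
  defines "A \<equiv> (Y - X ** B) ** transpose (Y - X ** B)"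
  assumes Q: "orthogonal_matrix Q" and S: "invertible S"
    and le: "objective lam X Y B S \<le> objective lam X Y B (Q ** S ** transpose Q)"
  shows "trace (matrix_inv S ** A) \<le> trace (Q ** matrix_inv S ** transpose Q ** A)"
proof -
  have "trace (matrix_inv S ** A) / (2 * real CARD('n) * real CARD('q))
      \<le> trace (Q ** matrix_inv S ** transpose Q ** A) / (2 * real CARD('n) * real CARD('q))"
    using le unfolding objective_def A_def
    by (simp add: matrix_inv_orthogonal_conj[OF Q S] trace_orthogonal_conj[OF Q]
        trace_transpose_sandwich)
  then show ?thesis by (simp add: divide_le_cancel)
qed

theorem lemma3:
  fixes X :: "real^'p^'n" and Y :: "real^'q^'n" and lam :: real
    and Bh :: "real^'q^'p" and Sh :: "real^'n^'n"
  assumes lam: "lam > 0"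
    and minimizer:
      "(feasible_a Sh \<and>
          (\<forall>B S. feasible_a S \<longrightarrow> objective lam X Y Bh Sh \<le> objective lam X Y B S))
       \<or> (\<exists>smin smax. 0 < smin \<and> smin < smax \<and> feasible_b smin smax Sh \<and>
          (\<forall>B S. feasible_b smin smax S \<longrightarrow> objective lam X Y Bh Sh \<le> objective lam X Y B S))"
  shows "norm2inf (transpose X ** (Y - X ** Bh))
           \<le> opnorm2 Sh * norm2inf (transpose X ** matrix_inv Sh ** (Y - X ** Bh))"
proof -
  define E where "E = Y - X ** Bh"
  have "pos_def Sh \<and> (\<forall>Q. orthogonal_matrix Q \<longrightarrow>
      objective lam X Y Bh Sh \<le> objective lam X Y Bh (Q ** Sh ** transpose Q))"
    using minimizer feasible_a_orthogonal_conj feasible_b_orthogonal_conj feasible_b_pos_def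
    unfolding feasible_a_def by metis
  then have pd: "pos_def Sh"
    and conj_min: "\<And>Q. orthogonal_matrix Q \<Longrightarrow>
      objective lam X Y Bh Sh \<le> objective lam X Y Bh (Q ** Sh ** transpose Q)"
    by blast+
  have sym: "symmetric_mat Sh" and inv: "invertible Sh"
    using pd pos_def_invertible by (auto simp: pos_def_def)
  have min: "trace (matrix_inv Sh ** (E ** transpose E))
      \<le> trace (Q ** matrix_inv Sh ** transpose Q ** (E ** transpose E))"
    if "orthogonal_matrix Q" for Q
    unfolding E_def by (rule trace_inv_le_of_objective_le[OF that inv conj_min[OF that]])
  have "symmetric_mat (E ** transpose E)"
    by (simp add: symmetric_mat_def matrix_transpose_mul)
  with symmetric_matrix_inv[OF sym inv]
  have "matrix_inv Sh ** (E ** transpose E) = (E ** transpose E) ** matrix_inv Sh"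
    using min by (rule commute_of_trace_orthogonal_conj_min)
  then have "Sh ** (E ** transpose E) = (E ** transpose E) ** Sh"
    by (rule commute_of_matrix_inv_commute[OF inv])
  then show ?thesis
    unfolding E_def[symmetric] by (rule norm2inf_transpose_mult_commuting_le[OF sym inv])
qed

end
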